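(* The category $\mathbf{Semigp}$ of nonempty semigroups has no prime objects.
   Context: "Semigroup" means nonempty semigroup; $\mathbf{Semigp}$ is the category of all such semigroups with semigroup homomorphisms. A semigroup $X$ is a direct factor of a semigroup $Y$ (or: $Y$ admits $X$ as a direct factor) if $Y\cong X\times Z$ for some semigroup $Z$. An object $X$ of $\mathbf{Semigp}$ other than the final object (the one-element semigroup) is called prime (in the sense of Tarski) if, whenever an object $Y$ admits $X$ as a direct factor, and $Y=Y_0\times Y_1$ is another direct product decomposition of $Y$ (with $Y_0,Y_1$ semigroups), then one of $Y_0$, $Y_1$ admits $X$ as a direct factor. One-element semigroups are by definition not prime. *)

theory Defs
  imports "HOL-Algebra.Group"
begin

text \<open>Semigroups are represented by the \<open>monoid\<close> records of HOL-Algebra, so that the library's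
  homomorphisms, isomorphisms (\<open>\<cong>\<close>) and binary products (\<open>\<times>\<times>\<close>) apply. None of these notions,
  nor the locale below, constrains the field \<open>one\<close>, whose value is irrelevant.\<close>

locale semigp =
  fixes S (structure)
  assumes nonempty: "carrier S \<noteq> {}"
    and m_closed: "\<lbrakk>x \<in> carrier S; y \<in> carrier S\<rbrakk> \<Longrightarrow> x \<otimes> y \<in> carrier S"
    and m_assoc: "\<lbrakk>x \<in> carrier S; y \<in> carrier S; z \<in> carrier S\<rbrakk>
      \<Longrightarrow> (x \<otimes> y) \<otimes> z = x \<otimes> (y \<otimes> z)"

text \<open>The complementary factor \<open>Z\<close> may be taken over the type of \<open>Y\<close>, since it embeds in \<open>Y\<close>
  as a set: see \<open>direct_factorI\<close> below.\<close>

definition direct_factor :: "'a monoid \<Rightarrow> 'b monoid \<Rightarrow> bool" where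
  "direct_factor X Y \<longleftrightarrow> (\<exists>Z :: 'b monoid. semigp Z \<and> Y \<cong> X \<times>\<times> Z)"

text \<open>HOL cannot quantify over all types inside a formula, so primality refers to a universe
  \<open>'u\<close>: the test objects \<open>Y\<close>, \<open>Y\<^sub>0\<close>, \<open>Y\<^sub>1\<close> range over all nonempty semigroups whose carrier is
  a subset of \<open>'u\<close>. A larger universe gives a stronger property
  (\<open>tarski_prime_antimono\<close> below); primality in the class of all semigroups
  is primality relative to every universe. In a universe that is small compared with \<open>X\<close>
  the condition can hold vacuously, so a statement about non-existence of primes has to require
  \<open>'u\<close> to be large compared with the type of \<open>X\<close>; by the same monotonicity, non-primality in
  one universe is non-primality in the class of all semigroups.\<close>

definition tarski_prime :: "'u itself \<Rightarrow> 'a monoid \<Rightarrow> bool" where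
  "tarski_prime (_ :: 'u itself) X \<longleftrightarrow>
     semigp X \<and> \<not> is_singleton (carrier X) \<and>
     (\<forall>(Y :: 'u monoid) (Y0 :: 'u monoid) (Y1 :: 'u monoid).
        semigp Y \<and> semigp Y0 \<and> semigp Y1 \<and> direct_factor X Y \<and> Y \<cong> Y0 \<times>\<times> Y1
        \<longrightarrow> direct_factor X Y0 \<or> direct_factor X Y1)"

definition copy :: "('a \<Rightarrow> 'b) \<Rightarrow> 'a monoid \<Rightarrow> 'b monoid" where
  "copy f S = \<lparr>carrier = f ` carrier S,
     mult = (\<lambda>x y. f (inv_into (carrier S) f x \<otimes>\<^bsub>S\<^esub> inv_into (carrier S) f y)),
     one = f \<one>\<^bsub>S\<^esub>\<rparr>"

lemma copy_iso:
  assumes "semigp S" "inj_on f (carrier S)"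
  shows "f \<in> iso S (copy f S)"
  using assms by (auto simp: iso_def hom_def copy_def bij_betw_def)

lemma copy_semigp:
  assumes "semigp S" "inj_on f (carrier S)"
  shows "semigp (copy f S)"
proof -
  interpret semigp S by fact
  show ?thesis
    by unfold_locales
      (auto simp: copy_def nonempty assms(2) inv_into_f_f m_closed m_assoc)
qed

lemma semigp_DirProd:
  assumes "semigp S" "semigp T"
  shows "semigp (S \<times>\<times> T)"
proof -
  interpret S: semigp S by fact
  interpret T: semigp T by fact
  show ?thesis
    by unfold_locales
      (auto simp: DirProd_def S.nonempty T.nonempty S.m_closed T.m_closed S.m_assoc T.m_assoc)
qed

lemma semigp_is_iso_sym:
  assumes "semigp S" "S \<cong> T"
  shows "T \<cong> S"
proof -
  interpret semigp S by fact
  obtain h where h: "h \<in> hom S T" "bij_betw h (carrier S) (carrier T)"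
    using assms(2) by (auto simp: is_iso_def iso_def)
  let ?g = "inv_into (carrier S) h"
  have g: "bij_betw ?g (carrier T) (carrier S)"
    using h(2) by (rule bij_betw_inv_into)
  have "?g (x \<otimes>\<^bsub>T\<^esub> y) = ?g x \<otimes>\<^bsub>S\<^esub> ?g y" if "x \<in> carrier T" "y \<in> carrier T" for x y
  proof -
    have gc: "?g x \<in> carrier S" "?g y \<in> carrier S"
      using g that by (auto simp: bij_betw_def)
    have "h (?g x \<otimes>\<^bsub>S\<^esub> ?g y) = h (?g x) \<otimes>\<^bsub>T\<^esub> h (?g y)"
      using h(1) gc by (auto simp: hom_def)
    also have "\<dots> = x \<otimes>\<^bsub>T\<^esub> y"
      using that h(2) by (simp add: bij_betw_inv_into_right)
    finally show ?thesis
      using bij_betw_inv_into_left[OF h(2) m_closed[OF gc]] by simp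
  qed
  then have "?g \<in> iso T S"
    using g by (auto simp: iso_def hom_def bij_betw_def)
  then show ?thesis
    by (rule is_isoI)
qed

lemma is_iso_trans': "\<lbrakk>S \<cong> T; T \<cong> U\<rbrakk> \<Longrightarrow> S \<cong> U"
  unfolding is_iso_def using iso_set_trans by blast

lemma is_iso_DirProd:
  assumes "S \<cong> S'" "T \<cong> T'"
  shows "S \<times>\<times> T \<cong> S' \<times>\<times> T'"
proof -
  obtain f g where fg: "f \<in> iso S S'" "g \<in> iso T T'"
    using assms by (auto simp: is_iso_def)
  have "map_prod f g \<in> iso (S \<times>\<times> T) (S' \<times>\<times> T')"
    using fg bij_betw_map_prod[of f "carrier S" "carrier S'" g "carrier T" "carrier T'"]
    by (auto simp: iso_def hom_def DirProd_def Pi_iff)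
  then show ?thesis
    by (rule is_isoI)
qed

lemma is_iso_refl': "S \<cong> S"
  unfolding is_iso_def iso_def hom_def by (auto intro!: exI[of _ "\<lambda>x. x"] simp: bij_betw_def)

lemma direct_factorI:
  fixes X :: "'a monoid" and Y :: "'b monoid" and Z :: "'c monoid"
  assumes "semigp X" "semigp Z" "Y \<cong> X \<times>\<times> Z"
  shows "direct_factor X Y"
proof -
  interpret X: semigp X by fact
  interpret Z: semigp Z by fact
  obtain h where "h \<in> iso Y (X \<times>\<times> Z)"
    using assms(3) by (auto simp: is_iso_def)
  then have "bij_betw h (carrier Y) (carrier X \<times> carrier Z)"
    by (simp add: iso_def DirProd_def)
  then have g: "bij_betw (inv_into (carrier Y) h) (carrier X \<times> carrier Z) (carrier Y)"
    by (rule bij_betw_inv_into)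
  obtain x where x: "x \<in> carrier X"
    using X.nonempty by blast
  define f where "f z = inv_into (carrier Y) h (x, z)" for z
  have "inj_on f (carrier Z)"
    using bij_betw_imp_inj_on[OF g] x unfolding f_def inj_on_def by blast
  then have "semigp (copy f Z)" "Z \<cong> copy f Z"
    using copy_semigp copy_iso assms(2) is_isoI by blast+
  moreover from this have "Y \<cong> X \<times>\<times> copy f Z"
    using assms(3) is_iso_DirProd is_iso_refl' is_iso_trans' by blast
  ultimately show ?thesis
    unfolding direct_factor_def by blast
qed

lemma direct_factor_cong:
  assumes "semigp X" "semigp Y" "Y \<cong> Y'"
  shows "direct_factor X Y \<longleftrightarrow> direct_factor X Y'"
  using assms direct_factorI is_iso_trans' semigp_is_iso_sym unfolding direct_factor_def by metis

lemma tarski_prime_antimono: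
  fixes X :: "'a monoid" and f :: "'u \<Rightarrow> 'v"
  assumes prime: "tarski_prime TYPE('v) X" and f: "inj f"
  shows "tarski_prime TYPE('u) X"
proof -
  have X: "semigp X" "\<not> is_singleton (carrier X)"
    using prime by (auto simp: tarski_prime_def)
  have c: "semigp (copy f S)" "S \<cong> copy f S" "copy f S \<cong> S" if "semigp S" for S :: "'u monoid"
  proof -
    have "inj_on f (carrier S)"
      using f by (rule inj_on_subset) simp
    with that show "semigp (copy f S)" "S \<cong> copy f S"
      by (auto intro: copy_semigp copy_iso is_isoI)
    then show "copy f S \<cong> S"
      using that semigp_is_iso_sym by blast
  qed
  have "direct_factor X Y0 \<or> direct_factor X Y1"
    if Y: "semigp Y" "semigp Y0" "semigp Y1" and "direct_factor X Y" "Y \<cong> Y0 \<times>\<times> Y1"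
    for Y Y0 Y1 :: "'u monoid"
  proof -
    have "direct_factor X (copy f Y)"
      using direct_factor_cong[OF X(1) Y(1) c(2)[OF Y(1)]] that by blast
    moreover have "copy f Y \<cong> copy f Y0 \<times>\<times> copy f Y1"
      using is_iso_trans'[OF c(3)[OF Y(1)] is_iso_trans'[OF \<open>Y \<cong> Y0 \<times>\<times> Y1\<close>
          is_iso_DirProd[OF c(2)[OF Y(2)] c(2)[OF Y(3)]]]] .
    ultimately have "direct_factor X (copy f Y0) \<or> direct_factor X (copy f Y1)"
      using prime c(1) Y unfolding tarski_prime_def by blast
    then show ?thesis
      using direct_factor_cong[OF X(1) Y(2) c(2)[OF Y(2)]]
        direct_factor_cong[OF X(1) Y(3) c(2)[OF Y(3)]] by blast
  qed
  with X show ?thesis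
    unfolding tarski_prime_def by blast
qed

end

theory Submission
  imports Defs "HOL-Library.Equipollence"
    "HOL-Computational_Algebra.Primes"
    "HOL-Combinatorics.Transposition"
begin

text \<open>Call \<open>X\<close> null if all its products are equal. Whether \<open>X\<close> is null decides which of two
  constructions shows that \<open>X\<close> is not prime; both exploit that infinite cardinals absorb smaller ones,
  so that a defect of one factor \<open>Y\<^sub>1\<close> or \<open>Y\<^sub>0\<close> disappears in the product. Throughout, \<open>K\<close> is a set
  of cardinality \<open>2 ^ max \<bar>X\<bar> \<aleph>\<^sub>0\<close> or more.

  If \<open>X\<close> is not null, let \<open>Y\<^sub>0\<close> be the null semigroup on \<open>K\<close>, and let \<open>Y\<^sub>1\<close> be \<open>X\<close> with one single
  element \<open>x\<^sub>0\<close> inflated: \<open>\<bar>K\<bar>\<close> copies of \<open>x\<^sub>0\<close> that multiply like \<open>x\<^sub>0\<close>, and of which at most one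
  occurs as a product. In \<open>Y\<^sub>0 \<times> Y\<^sub>1\<close> every element of \<open>X\<close> is inflated \<open>\<bar>K\<bar>\<close> times, since
  \<open>\<bar>K\<bar>\<^sup>2 = \<bar>K\<bar>\<close>; hence \<open>Y\<^sub>0 \<times> Y\<^sub>1 \<cong> X \<times> Y\<^sub>0\<close>. The factor \<open>Y\<^sub>0\<close> is null, so all its factors are null.
  If \<open>Y\<^sub>1 \<cong> X \<times> Z\<close>, then, for reasons of cardinality, the \<open>\<bar>K\<bar>\<close> equally multiplying elements of
  \<open>Y\<^sub>1\<close> must have all elements of \<open>X\<close> among their \<open>X\<close>-coordinates; so any two elements of \<open>X\<close> multiply
  equally, and \<open>X\<close> is null after all (\<open>null_of_factor_inflate_at\<close>).

  If \<open>X\<close> is null, it is a factor of \<open>Y\<close> exactly when the elements of \<open>Y\<close> can be arranged in groups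
  of \<open>\<bar>X\<bar>\<close> equally multiplying ones so that at most one of each group is a product. Let \<open>Y\<^sub>0\<close> be a
  semigroup in which the annihilator consists of products only, while the other elements come in
  large groups of equally multiplying ones; and let \<open>Y\<^sub>1\<close> be a null semigroup with \<open>p\<close> elements, where
  \<open>p \<noteq> \<bar>X\<bar>\<close> is prime. In \<open>Y\<^sub>0\<close> no arrangement exists, because every annihilating element is a product;
  and \<open>\<bar>X\<bar>\<close> does not divide \<open>p\<close>. In \<open>Y\<^sub>0 \<times> Y\<^sub>1\<close>, however, there are as many annihilating non-products
  as products, and \<open>X \<times> (Y\<^sub>0 \<times> Y\<^sub>1) \<cong> Y\<^sub>0 \<times> Y\<^sub>1\<close>.\<close>

section \<open>Cardinal arithmetic and primality across types\<close>

lemma times_self_eqpoll_infinite: "infinite A \<Longrightarrow> A \<times> A \<approx> A"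
  unfolding eqpoll_iff_card_of_ordIso by (rule card_of_Times_same_infinite)

lemma times_lepoll_infinite:
  assumes "infinite C" "A \<lesssim> C" "B \<lesssim> C"
  shows "A \<times> B \<lesssim> C"
  using times_lepoll_mono[OF assms(2,3)] times_self_eqpoll_infinite[OF assms(1)] lepoll_trans2
  by blast

lemma plus_lepoll_infinite:
  assumes "infinite C" "A \<lesssim> C" "B \<lesssim> C"
  shows "A <+> B \<lesssim> C"
proof -
  have "C <+> C \<approx> C"
    unfolding eqpoll_iff_card_of_ordIso using card_of_Plus_infinite1[OF assms(1) card_of_mono1] by blast
  then show ?thesis
    using sum_lepoll_mono[OF assms(2,3)] lepoll_trans2 by blast
qed

text \<open>The test objects need not live on the universe itself: semigroups over any types will do,
  provided that their carriers embed in it.\<close>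

lemma tarski_primeD:
  fixes X :: "'a monoid" and Y0 :: "'b monoid" and Y1 :: "'c monoid" and Z :: "'d monoid"
  assumes prime: "tarski_prime TYPE('u) X" and inf: "infinite (UNIV :: 'u set)"
    and S: "semigp Y0" "semigp Y1" "semigp Z"
    and le: "carrier Y0 \<lesssim> (UNIV :: 'u set)" "carrier Y1 \<lesssim> (UNIV :: 'u set)"
    and iso: "Y0 \<times>\<times> Y1 \<cong> X \<times>\<times> Z"
  shows "direct_factor X Y0 \<or> direct_factor X Y1"
proof -
  have X: "semigp X"
    using prime by (simp add: tarski_prime_def)
  have "carrier (Y0 \<times>\<times> Y1) \<lesssim> (UNIV :: 'u set)"
    using times_lepoll_infinite[OF inf le] by (simp add: DirProd_def)
  then obtain g0 g1 g where
    g: "inj_on (g0 :: 'b \<Rightarrow> 'u) (carrier Y0)" "inj_on (g1 :: 'c \<Rightarrow> 'u) (carrier Y1)"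
      "inj_on (g :: 'b \<times> 'c \<Rightarrow> 'u) (carrier (Y0 \<times>\<times> Y1))"
    using le unfolding lepoll_def by metis
  define C0 C1 C where C: "C0 = copy g0 Y0" "C1 = copy g1 Y1" "C = copy g (Y0 \<times>\<times> Y1)"
  have P: "semigp (Y0 \<times>\<times> Y1)"
    using S by (intro semigp_DirProd)
  have semi: "semigp C0" "semigp C1" "semigp C"
    unfolding C using S P g by (auto intro: copy_semigp)
  have isos: "Y0 \<cong> C0" "Y1 \<cong> C1" "Y0 \<times>\<times> Y1 \<cong> C"
    unfolding C using copy_iso[OF S(1) g(1)] copy_iso[OF S(2) g(2)] copy_iso[OF P g(3)]
    by (auto intro: is_isoI)
  have "C \<cong> Y0 \<times>\<times> Y1"
    using semigp_is_iso_sym[OF P isos(3)] .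
  then have "C \<cong> C0 \<times>\<times> C1" "C \<cong> X \<times>\<times> Z"
    using is_iso_trans' is_iso_DirProd[OF isos(1,2)] iso by blast+
  then have "direct_factor X C0 \<or> direct_factor X C1"
    using prime semi direct_factorI[OF X S(3)] unfolding tarski_prime_def by blast
  then show ?thesis
    using direct_factor_cong[OF X S(1) isos(1)] direct_factor_cong[OF X S(2) isos(2)] by blast
qed

lemma direct_factorE:
  assumes "direct_factor (X :: 'a monoid) (Y :: 'b monoid)"
  obtains Z :: "'b monoid" and h where "semigp Z"
    "bij_betw h (carrier Y) (carrier X \<times> carrier Z)"
    "\<forall>s\<in>carrier Y. \<forall>t\<in>carrier Y.
       h (s \<otimes>\<^bsub>Y\<^esub> t) = (fst (h s) \<otimes>\<^bsub>X\<^esub> fst (h t), snd (h s) \<otimes>\<^bsub>Z\<^esub> snd (h t))"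
proof -
  obtain Z :: "'b monoid" and h where Z: "semigp Z" and h: "h \<in> iso Y (X \<times>\<times> Z)"
    using assms unfolding direct_factor_def is_iso_def by blast
  have "bij_betw h (carrier Y) (carrier X \<times> carrier Z)"
    using h by (simp add: iso_def DirProd_def)
  moreover have "h (s \<otimes>\<^bsub>Y\<^esub> t) = (fst (h s) \<otimes>\<^bsub>X\<^esub> fst (h t), snd (h s) \<otimes>\<^bsub>Z\<^esub> snd (h t))"
    if "s \<in> carrier Y" "t \<in> carrier Y" for s t
    using h that by (simp add: iso_def hom_def DirProd_def case_prod_unfold)
  ultimately show ?thesis
    using that Z by blast
qed

section \<open>Null semigroups\<close>

definition null_semigp :: "'b set \<Rightarrow> 'b \<Rightarrow> 'b monoid" where
  "null_semigp A c = \<lparr>carrier = A, monoid.mult = (\<lambda>_ _. c), one = c\<rparr>"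

definition is_null :: "'a monoid \<Rightarrow> bool" where
  "is_null X \<longleftrightarrow> (\<exists>e\<in>carrier X. \<forall>x\<in>carrier X. \<forall>y\<in>carrier X. x \<otimes>\<^bsub>X\<^esub> y = e)"

lemma null_semigp_simps [simp]:
  "carrier (null_semigp A c) = A" "x \<otimes>\<^bsub>null_semigp A c\<^esub> y = c"
  by (simp_all add: null_semigp_def)

lemma semigp_null_semigp: "c \<in> A \<Longrightarrow> semigp (null_semigp A c)"
  by unfold_locales auto

lemma is_null_of_factor_null_semigp:
  fixes A :: "'b set"
  assumes X: "semigp X" and f: "direct_factor X (null_semigp A c)"
  shows "is_null X"
proof -
  interpret X: semigp X by fact
  obtain Z :: "'b monoid" and h where Z: "semigp Z" and bij: "bij_betw h A (carrier X \<times> carrier Z)"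
    and hom: "\<forall>s\<in>A. \<forall>t\<in>A.
       h c = (fst (h s) \<otimes>\<^bsub>X\<^esub> fst (h t), snd (h s) \<otimes>\<^bsub>Z\<^esub> snd (h t))"
    using direct_factorE[OF f, unfolded null_semigp_simps] .
  obtain z where z: "z \<in> carrier Z"
    using semigp.nonempty[OF Z] by blast
  have *: "x \<otimes>\<^bsub>X\<^esub> y = fst (h c)" if "x \<in> carrier X" "y \<in> carrier X" for x y
  proof -
    have "(x, z) \<in> h ` A" "(y, z) \<in> h ` A"
      using bij that z by (auto simp: bij_betw_def)
    then obtain s t where "s \<in> A" "h s = (x, z)" "t \<in> A" "h t = (y, z)"
      by (auto simp: image_iff)
    then show ?thesis
      using hom[THEN bspec, of s, THEN bspec, of t] by simp
  qed
  then have "fst (h c) \<in> carrier X"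
    using X.nonempty X.m_closed by fastforce
  with * show ?thesis
    unfolding is_null_def by blast
qed

text \<open>\<open>\<bar>X\<bar>\<close> would have to divide the prime \<open>p\<close>. This includes infinite \<open>X\<close>, for which \<open>card\<close> is 0.\<close>

lemma not_factor_null_semigp_prime:
  assumes X: "\<not> is_singleton (carrier X)" and p: "prime (p :: nat)" "card (carrier X) \<noteq> p"
  shows "\<not> direct_factor X (null_semigp {..<p} c)"
proof
  assume "direct_factor X (null_semigp {..<p} c)"
  then obtain Z :: "nat monoid" and h where "bij_betw h {..<p} (carrier X \<times> carrier Z)"
    by (elim direct_factorE) auto
  then have "card (carrier X) * card (carrier Z) = p"
    using bij_betw_same_card card_cartesian_product by (metis card_lessThan)
  then have "card (carrier X) = 1 \<or> card (carrier X) = p"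
    using p(1) by (metis dvd_triv_left prime_nat_iff)
  then show False
    using X p(2) by (simp add: is_singleton_altdef)
qed

section \<open>Inflation at a single element\<close>

definition inflate_at :: "'a monoid \<Rightarrow> 'a \<Rightarrow> 'k \<Rightarrow> ('a \<times> 'k) monoid" where
  "inflate_at X x0 k0 = \<lparr>carrier = {(x, k). x \<in> carrier X \<and> (x = x0 \<or> k = k0)},
     monoid.mult = (\<lambda>s t. (fst s \<otimes>\<^bsub>X\<^esub> fst t, k0)), one = (x0, k0)\<rparr>"

lemma inflate_at_simps [simp]:
  "carrier (inflate_at X x0 k0) = {(x, k). x \<in> carrier X \<and> (x = x0 \<or> k = k0)}"
  "s \<otimes>\<^bsub>inflate_at X x0 k0\<^esub> t = (fst s \<otimes>\<^bsub>X\<^esub> fst t, k0)"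
  by (simp_all add: inflate_at_def)

lemma semigp_inflate_at:
  assumes "semigp X"
  shows "semigp (inflate_at X x0 k0)"
proof -
  interpret semigp X by fact
  show ?thesis
    using nonempty by unfold_locales (auto simp: m_closed m_assoc)
qed

text \<open>In the product each element of \<open>X\<close> is inflated by a set of size \<open>\<bar>K\<bar>\<close>: by \<open>K \<times> {k0}\<close> in
  general, and by \<open>K \<times> K\<close> at \<open>x0\<close>. Only the copy with all labels \<open>k0\<close> can occur as a product, and the
  isomorphism has to give it the label \<open>k0\<close> again; a bijection between \<open>K \<times> K\<close> and \<open>K\<close> is therefore
  adjusted by a transposition.\<close>

lemma null_times_inflate_at_iso:
  fixes k0 :: 'k
  assumes inf: "infinite (UNIV :: 'k set)"
  shows "null_semigp UNIV k0 \<times>\<times> inflate_at X x0 k0 \<cong> X \<times>\<times> null_semigp UNIV k0"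
proof -
  have "(UNIV :: 'k set) \<times> (UNIV :: 'k set) \<approx> (UNIV :: 'k set)"
    using times_self_eqpoll_infinite[OF inf] .
  then obtain b :: "'k \<times> 'k \<Rightarrow> 'k" where b: "bij b"
    unfolding eqpoll_def by auto
  define \<beta> where "\<beta> = Transposition.transpose (b (k0, k0)) k0 \<circ> b"
  have \<beta>: "bij \<beta>" "\<beta> (k0, k0) = k0"
    unfolding \<beta>_def using b by (auto intro: bij_comp)
  define h where "h = (\<lambda>(l, x, k). (x, if x = x0 then \<beta> (l, k) else l))"
  have inj: "inj_on h (UNIV \<times> carrier (inflate_at X x0 k0))"
  proof (rule inj_onI, clarsimp simp: h_def split: if_splits)
    fix l k l' k'
    assume "\<beta> (l, k) = \<beta> (l', k')"
    then show "l = l' \<and> k = k'"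
      using bij_is_inj[OF \<beta>(1)] by (auto dest: injD)
  qed
  have "(x, m) \<in> h ` (UNIV \<times> carrier (inflate_at X x0 k0))" if x: "x \<in> carrier X" for x m
  proof (cases "x = x0")
    case True
    obtain l k where "\<beta> (l, k) = m"
      using bij_is_surj[OF \<beta>(1)] by (metis surjD surj_pair)
    with True x show ?thesis
      by (intro image_eqI[of _ _ "(l, x, k)"]) (auto simp: h_def)
  next
    case False
    with x show ?thesis
      by (intro image_eqI[of _ _ "(m, x, k0)"]) (auto simp: h_def)
  qed
  then have "h ` (UNIV \<times> carrier (inflate_at X x0 k0)) = carrier X \<times> UNIV"
    by (auto simp: h_def)
  with inj have "h \<in> iso (null_semigp UNIV k0 \<times>\<times> inflate_at X x0 k0) (X \<times>\<times> null_semigp UNIV k0)"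
    by (auto simp: iso_def hom_def bij_betw_def DirProd_def h_def \<beta>(2))
  then show ?thesis
    by (rule is_isoI)
qed

text \<open>Let \<open>h\<close> identify the inflated semigroup with \<open>X \<times> Z\<close>, and let \<open>D\<close> be the set of
  \<open>Z\<close>-coordinates of the copies of \<open>x0\<close>. Since these \<open>\<bar>K\<bar>\<close> copies embed in \<open>X \<times> D\<close>, the set \<open>D\<close> is
  larger than \<open>X\<close>. So for each \<open>x\<close> the set \<open>{x} \<times> D\<close> cannot consist of images of elements
  \<open>(y, k0)\<close> with \<open>y \<noteq> x0\<close> alone, and contains the image of a copy of \<open>x0\<close>.
  All these copies multiply equally; hence so do all \<open>x\<close>.\<close>

lemma null_of_factor_inflate_at:
  fixes X :: "'a monoid" and k0 :: 'k and M :: "'m set"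
  assumes X: "semigp X" and x0: "x0 \<in> carrier X"
    and M: "infinite M" "carrier X \<lesssim> M" "M \<prec> (UNIV :: 'k set)"
    and f: "direct_factor X (inflate_at X x0 k0)"
  shows "is_null X"
proof -
  interpret X: semigp X by fact
  obtain Z :: "('a \<times> 'k) monoid" and h where Z: "semigp Z"
    and bij: "bij_betw h (carrier (inflate_at X x0 k0)) (carrier X \<times> carrier Z)"
    and hom': "\<forall>s\<in>carrier (inflate_at X x0 k0). \<forall>t\<in>carrier (inflate_at X x0 k0).
       h (s \<otimes>\<^bsub>inflate_at X x0 k0\<^esub> t) = (fst (h s) \<otimes>\<^bsub>X\<^esub> fst (h t), snd (h s) \<otimes>\<^bsub>Z\<^esub> snd (h t))"
    using direct_factorE[OF f] .
  let ?Y = "carrier (inflate_at X x0 k0)"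
  have hom: "fst (h s) \<otimes>\<^bsub>X\<^esub> fst (h t) = fst (h (fst s \<otimes>\<^bsub>X\<^esub> fst t, k0))"
    if "s \<in> ?Y" "t \<in> ?Y" for s t
    using hom'[THEN bspec, OF that(1), THEN bspec, OF that(2)] by simp
  have onto: "h ` ?Y = carrier X \<times> carrier Z" and inj: "inj_on h ?Y"
    using bij by (auto simp: bij_betw_def)
  have copies: "(x0, k) \<in> ?Y" for k
    using x0 by simp
  define D where "D = range (\<lambda>k. snd (h (x0, k)))"
  have inX: "h (x0, k) \<in> carrier X \<times> D" for k
  proof -
    have "h (x0, k) \<in> carrier X \<times> carrier Z"
      using onto copies by blast
    then show ?thesis
      by (auto simp: D_def mem_Times_iff)
  qed
  have D_sub: "D \<subseteq> carrier Z"
  proof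
    fix d assume "d \<in> D"
    then obtain k where "d = snd (h (x0, k))"
      by (auto simp: D_def)
    moreover have "h (x0, k) \<in> carrier X \<times> carrier Z"
      using onto copies by blast
    ultimately show "d \<in> carrier Z"
      by (simp add: mem_Times_iff)
  qed
  have "inj (\<lambda>k. h (x0, k))"
    using inj copies by (auto intro!: injI dest: inj_onD)
  then have K_le: "(UNIV :: 'k set) \<lesssim> carrier X \<times> D"
    unfolding lepoll_def using inX by blast
  have ex: "\<exists>k. fst (h (x0, k)) = x" if x: "x \<in> carrier X" for x
  proof (rule ccontr)
    assume neg: "\<nexists>k. fst (h (x0, k)) = x"
    have "d \<in> (\<lambda>y. snd (h (y, k0))) ` carrier X" if "d \<in> D" for d
    proof -
      have "(x, d) \<in> h ` ?Y"
        using onto x D_sub that by blast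
      then obtain y k where "(y, k) \<in> ?Y" "h (y, k) = (x, d)"
        by (metis imageE surj_pair)
      moreover from this have "y \<noteq> x0"
        using neg by (metis fst_conv)
      ultimately show ?thesis
        by (intro image_eqI[of _ _ y]) auto
    qed
    then have "D \<lesssim> M"
      by (meson M(2) lepoll_trans subsetI subset_image_lepoll)
    then have "(UNIV :: 'k set) \<lesssim> M"
      using K_le M(1,2) times_lepoll_infinite lepoll_trans by blast
    then show False
      using M(3) by (meson lesspoll_not_refl lesspoll_trans1)
  qed
  have left: "x \<otimes>\<^bsub>X\<^esub> y = x' \<otimes>\<^bsub>X\<^esub> y" and right: "y \<otimes>\<^bsub>X\<^esub> x = y \<otimes>\<^bsub>X\<^esub> x'"
    if xs: "x \<in> carrier X" "x' \<in> carrier X" and y: "y \<in> carrier X" for x x' y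
  proof -
    obtain k k' l where "fst (h (x0, k)) = x" "fst (h (x0, k')) = x'" "fst (h (x0, l)) = y"
      using ex[OF xs(1)] ex[OF xs(2)] ex[OF y] by blast
    then show "x \<otimes>\<^bsub>X\<^esub> y = x' \<otimes>\<^bsub>X\<^esub> y" "y \<otimes>\<^bsub>X\<^esub> x = y \<otimes>\<^bsub>X\<^esub> x'"
      using hom[OF copies copies, of k l] hom[OF copies copies, of k' l]
        hom[OF copies copies, of l k] hom[OF copies copies, of l k'] by simp_all
  qed
  have "x \<otimes>\<^bsub>X\<^esub> y = x0 \<otimes>\<^bsub>X\<^esub> x0" if "x \<in> carrier X" "y \<in> carrier X" for x y
    using left[of x x0 y] right[of y x0 x0] that x0 by simp
  then show ?thesis
    using X.m_closed[OF x0 x0] unfolding is_null_def by blast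
qed

section \<open>A semigroup whose annihilator consists of products\<close>

text \<open>The elements \<open>Inl a\<close> annihilate everything, and each \<open>Inl a\<close> is the product of
  \<open>Inr (a, j)\<close> with any \<open>Inr\<close>. The coordinate \<open>j\<close> has no influence on products; it provides \<open>\<bar>K\<bar>\<close>
  equally multiplying copies of each non-annihilating element.\<close>

definition annihilator_of_products :: "'k \<Rightarrow> ('k + 'k \<times> 'k) monoid" where
  "annihilator_of_products k0 = \<lparr>carrier = UNIV,
     monoid.mult = (\<lambda>s t. case (s, t) of (Inr (i, _), Inr _) \<Rightarrow> Inl i | _ \<Rightarrow> Inl k0), one = Inl k0\<rparr>"

lemma annihilator_of_products_simps [simp]:
  "carrier (annihilator_of_products k0) = UNIV"
  "Inl a \<otimes>\<^bsub>annihilator_of_products k0\<^esub> t = Inl k0"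
  "s \<otimes>\<^bsub>annihilator_of_products k0\<^esub> Inl a = Inl k0"
  "Inr (i, j) \<otimes>\<^bsub>annihilator_of_products k0\<^esub> Inr q = Inl i"
  by (auto simp: annihilator_of_products_def split: sum.split)

lemma semigp_annihilator_of_products: "semigp (annihilator_of_products k0)"
proof (unfold_locales, goal_cases)
  case (3 x y z)
  show ?case
    by (cases x; cases y; cases z) auto
qed auto

text \<open>With \<open>e\<close> the only product of \<open>X\<close> and \<open>x \<noteq> e\<close>, compare \<open>(x, z)\<close> with the annihilating element
  \<open>(e, z)\<close> that corresponds to \<open>Inl k0\<close>. The former annihilates as well, so it would be a product;
  but products have \<open>X\<close>-coordinate \<open>e\<close>.\<close>

lemma not_factor_annihilator_of_products:
  fixes k0 :: 'k
  assumes inf: "infinite (UNIV :: 'k set)"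
    and X: "is_null X" "\<not> is_singleton (carrier X)"
  shows "\<not> direct_factor X (annihilator_of_products k0)"
proof
  let ?Y = "annihilator_of_products k0"
  assume f: "direct_factor X ?Y"
  obtain Z :: "('k + 'k \<times> 'k) monoid" and h where Z: "semigp Z"
    and bij: "bij_betw h (carrier ?Y) (carrier X \<times> carrier Z)"
    and hom': "\<forall>s\<in>carrier ?Y. \<forall>t\<in>carrier ?Y.
       h (s \<otimes>\<^bsub>?Y\<^esub> t) = (fst (h s) \<otimes>\<^bsub>X\<^esub> fst (h t), snd (h s) \<otimes>\<^bsub>Z\<^esub> snd (h t))"
    using direct_factorE[OF f] .
  obtain e where e: "e \<in> carrier X"
    and null: "\<And>x y. x \<in> carrier X \<Longrightarrow> y \<in> carrier X \<Longrightarrow> x \<otimes>\<^bsub>X\<^esub> y = e"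
    using X(1) unfolding is_null_def by blast
  obtain x where x: "x \<in> carrier X" "x \<noteq> e"
    using X(2) e by (metis empty_iff is_singletonI')
  have inj: "inj h" and onto: "range h = carrier X \<times> carrier Z"
    using bij by (auto simp: bij_betw_def)
  have h_in: "h s \<in> carrier X \<times> carrier Z" for s
    using onto by blast
  have hom: "h (s \<otimes>\<^bsub>?Y\<^esub> t) = (e, snd (h s) \<otimes>\<^bsub>Z\<^esub> snd (h t))" for s t
    using hom' h_in[of s] h_in[of t] null by (auto simp: mem_Times_iff)
  define z where "z = snd (h (Inl k0))"
  have "(x, z) \<in> range h"
    unfolding onto z_def using x(1) h_in[of "Inl k0"] by (simp add: mem_Times_iff)
  then obtain s where s: "h s = (x, z)"
    by (metis imageE)
  have "h (t \<otimes>\<^bsub>?Y\<^esub> s) = h (t \<otimes>\<^bsub>?Y\<^esub> Inl k0)" for t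
    unfolding hom by (simp add: s z_def)
  then have ann: "t \<otimes>\<^bsub>?Y\<^esub> s = Inl k0" for t
    using inj by (auto dest: injD)
  have "\<exists>a. s = Inl a"
  proof (cases s)
    case (Inr q)
    \<comment> \<open>Left multiplication by \<open>Inr (i, _)\<close> with \<open>i \<noteq> k0\<close> shows that \<open>Inr q\<close> does not annihilate.\<close>
    obtain i where "i \<noteq> k0"
      using ex_new_if_finite[OF inf, of "{k0}"] by auto
    then show ?thesis
      using ann[of "Inr (i, i)"] Inr by simp
  qed simp
  then obtain a where "s = Inl a" ..
  then have "s = Inr (a, a) \<otimes>\<^bsub>?Y\<^esub> Inr (a, a)"
    by simp
  then show False
    using hom s x(2) by (metis fst_conv)
qed


text \<open>Let \<open>e\<close> be the only product of \<open>X\<close>. The elements \<open>(Inr (i, j), n)\<close> are matched by a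
  bijection between \<open>K\<close> and \<open>X \<times> K\<close>, applied to \<open>j\<close>. For the elements \<open>(Inl a, n)\<close> a bijection
  between \<open>K \<times> N\<close> and \<open>X \<times> K \<times> N\<close> is needed that sends the product \<open>(a, c)\<close> to \<open>(e, a, c)\<close>. It
  exists because in both sets the elements that are not of these forms are \<open>\<bar>K\<bar>\<close> in number; on the
  left this is where the second element of \<open>N\<close> is used.\<close>

lemma annihilator_of_products_times_null_iso:
  fixes X :: "'a monoid" and k0 :: 'k
  assumes inf: "infinite (UNIV :: 'k set)"
    and X: "is_null X" "\<not> is_singleton (carrier X)" "carrier X \<lesssim> (UNIV :: 'k set)"
    and N: "finite N" "c \<in> N" "d \<in> N" "d \<noteq> c"
  defines "Y \<equiv> annihilator_of_products k0 \<times>\<times> null_semigp N c"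
  shows "Y \<cong> X \<times>\<times> Y"
proof -
  let ?K = "UNIV :: 'k set"
  obtain e where e: "e \<in> carrier X"
    and null: "\<And>x y. x \<in> carrier X \<Longrightarrow> y \<in> carrier X \<Longrightarrow> x \<otimes>\<^bsub>X\<^esub> y = e"
    using X(1) unfolding is_null_def by blast
  obtain x1 where x1: "x1 \<in> carrier X" "x1 \<noteq> e"
    using X(2) e by (metis empty_iff is_singletonI')
  have N_le: "N \<lesssim> ?K"
    using finite_lepoll_infinite[OF inf N(1)] .
  have "?K \<approx> carrier X \<times> ?K"
    using e by (intro lepoll_antisym lepoll_times2 times_lepoll_infinite inf X(3)) auto
  then obtain \<gamma> where \<gamma>: "bij_betw \<gamma> ?K (carrier X \<times> ?K)"
    unfolding eqpoll_def by blast
  define A where "A = ?K \<times> (N - {c})"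
  define B where "B = carrier X \<times> ?K \<times> N - {e} \<times> ?K \<times> {c}"
  have "A \<approx> B"
  proof (rule lepoll_antisym)
    have "A \<lesssim> ?K"
      unfolding A_def
      by (intro times_lepoll_infinite inf lepoll_refl finite_lepoll_infinite) (simp add: N(1))
    also have "?K \<lesssim> B"
      unfolding lepoll_def B_def using x1 N(2)
      by (intro exI[of _ "\<lambda>k. (x1, k, c)"]) (auto intro: inj_onI)
    finally show "A \<lesssim> B" .
    have "B \<lesssim> carrier X \<times> ?K \<times> N"
      unfolding B_def by (rule subset_imp_lepoll) blast
    also have "\<dots> \<lesssim> ?K"
      by (intro times_lepoll_infinite inf X(3) lepoll_refl N_le)
    also have "?K \<lesssim> A"
      unfolding A_def using N(3,4) by (intro lepoll_times1) blast
    finally show "B \<lesssim> A" .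
  qed
  then obtain g where g: "bij_betw g A B"
    unfolding eqpoll_def by blast
  define \<delta> where "\<delta> = (\<lambda>(a, n). if n = c then (e, a, c) else g (a, n))"
  have "bij_betw \<delta> (A \<union> ?K \<times> {c}) (B \<union> {e} \<times> ?K \<times> {c})"
  proof (rule bij_betw_combine)
    have "bij_betw \<delta> A B \<longleftrightarrow> bij_betw g A B"
      by (rule bij_betw_cong) (auto simp: \<delta>_def A_def split: if_splits)
    with g show "bij_betw \<delta> A B"
      by simp
    show "bij_betw \<delta> (?K \<times> {c}) ({e} \<times> ?K \<times> {c})"
      by (rule bij_betw_byWitness[of _ snd]) (auto simp: \<delta>_def)
  qed (auto simp: B_def)
  moreover have "A \<union> ?K \<times> {c} = ?K \<times> N" "B \<union> {e} \<times> ?K \<times> {c} = carrier X \<times> ?K \<times> N"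
    using N(2) e by (auto simp: A_def B_def)
  ultimately have \<delta>: "bij_betw \<delta> (?K \<times> N) (carrier X \<times> ?K \<times> N)"
    by simp
  define h :: "('k + 'k \<times> 'k) \<times> 'b \<Rightarrow> 'a \<times> ('k + 'k \<times> 'k) \<times> 'b" where
    "h = (\<lambda>(s, n). case s of
        Inl a \<Rightarrow> (case \<delta> (a, n) of (x, b, m) \<Rightarrow> (x, Inl b, m))
      | Inr (i, j) \<Rightarrow> (case \<gamma> j of (x, j') \<Rightarrow> (x, Inr (i, j'), n)))"
  have h_Inl: "h (Inl a, n) = (x, Inl b, m)" if "\<delta> (a, n) = (x, b, m)" for a n x b m
    using that by (simp add: h_def)
  have h_Inr: "h (Inr (i, j), n) = (x, Inr (i, j'), n)" if "\<gamma> j = (x, j')" for i j n x j'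
    using that by (simp add: h_def)
  have \<gamma>_in: "\<gamma> j \<in> carrier X \<times> ?K" for j
    using \<gamma> by (auto simp: bij_betw_def)
  have \<delta>_in: "\<delta> (a, n) \<in> carrier X \<times> ?K \<times> N" if "n \<in> N" for a n
    using \<delta> that by (auto simp: bij_betw_def)
  \<comment> \<open>Products depend only on the distinction between \<open>Inl\<close> and \<open>Inr\<close> and on the index \<open>i\<close>, all of
    which \<open>h\<close> preserves.\<close>
  have h_form: "\<exists>x\<in>carrier X. \<exists>m\<in>N. \<exists>t. h (s, n) = (x, t, m) \<and>
      (\<forall>a. s = Inl a \<longrightarrow> (\<exists>b. t = Inl b)) \<and> (\<forall>i j. s = Inr (i, j) \<longrightarrow> (\<exists>j'. t = Inr (i, j')))"
    if n: "n \<in> N" for s n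
  proof (cases s)
    case (Inl a)
    obtain x b m where "\<delta> (a, n) = (x, b, m)"
      by (metis surj_pair)
    with Inl h_Inl[OF this] \<delta>_in[OF n, of a] show ?thesis
      by auto
  next
    case (Inr q)
    obtain i j x j' where "q = (i, j)" "\<gamma> j = (x, j')"
      by (metis surj_pair)
    with Inr h_Inr[OF this(2)] \<gamma>_in[of j] n show ?thesis
      by auto
  qed
  have inj: "inj_on h (UNIV \<times> N)"
  proof (rule inj_onI, clarify)
    fix s n t m
    assume nm: "n \<in> N" "m \<in> N" and eq: "h (s, n) = h (t, m)"
    show "s = t \<and> n = m"
    proof (cases s; cases t)
      fix a b assume st: "s = Inl a" "t = Inl b"
      have "\<delta> (a, n) = \<delta> (b, m)"
        using eq st by (auto simp: h_def split: prod.splits)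
      then show ?thesis
        using \<delta> nm st unfolding bij_betw_def by (auto dest: inj_onD)
    next
      fix p q assume st: "s = Inr p" "t = Inr q"
      have "\<gamma> (snd p) = \<gamma> (snd q)" "fst p = fst q" "n = m"
        using eq st by (auto simp: h_def split: prod.splits)
      moreover from this(1) have "snd p = snd q"
        using \<gamma> unfolding bij_betw_def by (auto dest: injD)
      ultimately show ?thesis
        using st by (simp add: prod_eq_iff)
    qed (use eq in \<open>auto simp: h_def split: prod.splits\<close>)
  qed
  have onto: "(x, t, m) \<in> h ` (UNIV \<times> N)" if xm: "x \<in> carrier X" "m \<in> N" for x t m
  proof (cases t)
    case (Inl b)
    have "(x, b, m) \<in> \<delta> ` (?K \<times> N)"
      using \<delta> xm by (simp add: bij_betw_def)
    then obtain a n where "n \<in> N" "\<delta> (a, n) = (x, b, m)"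
      by auto
    with Inl show ?thesis
      by (intro image_eqI[of _ _ "(Inl a, n)"]) (simp_all add: h_Inl)
  next
    case (Inr q)
    have "(x, snd q) \<in> range \<gamma>"
      using \<gamma> xm by (simp add: bij_betw_def)
    then obtain j where "\<gamma> j = (x, snd q)"
      by (auto simp: image_iff)
    then have "h (Inr (fst q, j), m) = (x, t, m)"
      using h_Inr Inr by simp
    with xm(2) show ?thesis
      by (intro image_eqI[of _ _ "(Inr (fst q, j), m)"]) simp_all
  qed
  have "h ` (UNIV \<times> N) = carrier X \<times> UNIV \<times> N"
  proof
    show "h ` (UNIV \<times> N) \<subseteq> carrier X \<times> UNIV \<times> N"
    proof (rule image_subsetI)
      fix v :: "('k + 'k \<times> 'k) \<times> 'b"
      assume "v \<in> UNIV \<times> N"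
      then show "h v \<in> carrier X \<times> UNIV \<times> N"
        using h_form[of "snd v" "fst v"] by auto
    qed
    show "carrier X \<times> UNIV \<times> N \<subseteq> h ` (UNIV \<times> N)"
      using onto by auto
  qed
  with inj have bij: "bij_betw h (carrier Y) (carrier (X \<times>\<times> Y))"
    by (simp add: bij_betw_def Y_def DirProd_def)
  have h_prod: "h (Inl a, c) = (e, Inl a, c)" for a
    by (simp add: h_def \<delta>_def)
  have hom: "h (u \<otimes>\<^bsub>Y\<^esub> v) = h u \<otimes>\<^bsub>X \<times>\<times> Y\<^esub> h v" if uv: "u \<in> carrier Y" "v \<in> carrier Y" for u v
  proof -
    obtain s n t m where st: "u = (s, n)" "v = (t, m)" "n \<in> N" "m \<in> N"
      using uv by (auto simp: Y_def DirProd_def)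
    obtain x s' n' where s: "x \<in> carrier X" "h u = (x, s', n')"
        "\<And>a. s = Inl a \<Longrightarrow> \<exists>b. s' = Inl b" "\<And>i j. s = Inr (i, j) \<Longrightarrow> \<exists>j'. s' = Inr (i, j')"
      using h_form[OF st(3), of s] st(1) by blast
    obtain y t' m' where t: "y \<in> carrier X" "h v = (y, t', m')"
        "\<And>a. t = Inl a \<Longrightarrow> \<exists>b. t' = Inl b" "\<And>i j. t = Inr (i, j) \<Longrightarrow> \<exists>j'. t' = Inr (i, j')"
      using h_form[OF st(4), of t] st(2) by blast
    let ?S = "annihilator_of_products k0"
    have same: "s' \<otimes>\<^bsub>?S\<^esub> t' = s \<otimes>\<^bsub>?S\<^esub> t"
    proof (cases s)
      case (Inl a)
      then show ?thesis
        using s(3) by fastforce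
    next
      case (Inr p)
      then obtain i j j' where ij: "s = Inr (i, j)" "s' = Inr (i, j')"
        using s(4) by (metis surj_pair)
      show ?thesis
      proof (cases t)
        case (Inl b)
        then show ?thesis
          using t(3) by fastforce
      next
        case (Inr q)
        then obtain q' where "t' = Inr q'"
          using t(4) by (metis surj_pair)
        with Inr ij show ?thesis
          by simp
      qed
    qed
    have "\<exists>a. s \<otimes>\<^bsub>?S\<^esub> t = Inl a"
      by (cases s; cases t) auto
    then show ?thesis
      using same s(1,2) t(1,2) st(1,2) h_prod null by (auto simp: Y_def DirProd_def)
  qed
  have "h \<in> hom Y (X \<times>\<times> Y)"
    by (intro homI hom bij_betwE[OF bij, THEN bspec])
  with bij have "h \<in> iso Y (X \<times>\<times> Y)"
    by (simp add: iso_def)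
  then show ?thesis
    by (rule is_isoI)
qed

section \<open>There are no prime semigroups\<close>

theorem theorem2p7:
  fixes f :: "('a + nat) set \<Rightarrow> 'u"
  assumes "inj f"
  shows "\<not> (\<exists>X :: 'a monoid. tarski_prime TYPE('u) X)"
proof
  assume "\<exists>X :: 'a monoid. tarski_prime TYPE('u) X"
  then obtain X :: "'a monoid" where prime_u: "tarski_prime TYPE('u) X" ..
  let ?M = "UNIV :: ('a + nat) set" and ?K = "UNIV :: ('a + nat) set set"
  have prime: "tarski_prime TYPE(('a + nat) set) X"
    using tarski_prime_antimono[OF prime_u assms] .
  have X: "semigp X" and nontriv: "\<not> is_singleton (carrier X)"
    using prime by (auto simp: tarski_prime_def)
  have M: "infinite ?M"
    by (simp add: finite_Plus_UNIV_iff)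
  have K: "infinite ?K"
    using M by (simp add: Finite_Set.finite_set)
  have M_K: "?M \<prec> ?K"
    using lesspoll_Pow_self[of ?M] by simp
  have X_M: "carrier X \<lesssim> ?M"
    unfolding lepoll_def by (intro exI[of _ Inl]) auto
  have X_K: "carrier X \<lesssim> ?K"
    using X_M M_K lepoll_trans lesspoll_imp_lepoll by blast
  define k0 :: "('a + nat) set" where "k0 = {}"
  show False
  proof (cases "is_null X")
    case False
    obtain x0 where x0: "x0 \<in> carrier X"
      using semigp.nonempty[OF X] by blast
    let ?Y0 = "null_semigp ?K k0" and ?Y1 = "inflate_at X x0 k0"
    have "carrier ?Y1 \<lesssim> carrier X \<times> ?K"
      by (rule subset_imp_lepoll) auto
    also have "\<dots> \<lesssim> ?K"
      by (intro times_lepoll_infinite K X_K lepoll_refl)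
    finally have le: "carrier ?Y1 \<lesssim> ?K" .
    have "direct_factor X ?Y0 \<or> direct_factor X ?Y1"
    proof (rule tarski_primeD[OF prime K])
      show "?Y0 \<times>\<times> ?Y1 \<cong> X \<times>\<times> ?Y0"
        by (rule null_times_inflate_at_iso[OF K])
    qed (use le in \<open>simp_all add: semigp_null_semigp semigp_inflate_at[OF X]\<close>)
    moreover have "\<not> direct_factor X ?Y0"
      using is_null_of_factor_null_semigp[OF X] False by metis
    moreover have "\<not> direct_factor X ?Y1"
      using null_of_factor_inflate_at[OF X x0 M X_M M_K] False by metis
    ultimately show False
      by simp
  next
    case True
    define p :: nat where "p = (if card (carrier X) = 2 then 3 else 2)"
    have p: "prime p" "card (carrier X) \<noteq> p" "0 \<in> {..<p}" "1 \<in> {..<p}"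
      by (auto simp: p_def)
    let ?Y0 = "annihilator_of_products k0" and ?Y1 = "null_semigp {..<p} 0"
    have Y1: "semigp ?Y1"
      using semigp_null_semigp[OF p(3)] .
    have "?K <+> ?K \<times> ?K \<lesssim> ?K"
      by (intro plus_lepoll_infinite times_lepoll_infinite K lepoll_refl)
    then have le0: "carrier ?Y0 \<lesssim> ?K"
      by simp
    have le1: "carrier ?Y1 \<lesssim> ?K"
      by (rule finite_lepoll_infinite[OF K]) simp
    have "finite {..<p}" "(1 :: nat) \<noteq> 0"
      by simp_all
    note iso = annihilator_of_products_times_null_iso[OF K True nontriv X_K this(1) p(3,4) this(2)]
    have "direct_factor X ?Y0 \<or> direct_factor X ?Y1"
      by (rule tarski_primeD[OF prime K semigp_annihilator_of_products Y1
            semigp_DirProd[OF semigp_annihilator_of_products Y1] le0 le1 iso])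
    moreover have "\<not> direct_factor X ?Y0"
      by (rule not_factor_annihilator_of_products[OF K True nontriv])
    moreover have "\<not> direct_factor X ?Y1"
      by (rule not_factor_null_semigp_prime[OF nontriv p(1,2)])
    ultimately show False
      by simp
  qed
qed

end
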